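(* Let $G=G(V,E)$ be a simple graph. The Interval-Reversal random walk on the acyclic orientations of $G$ is a simple random walk on the graph $\mathrm{AO}^{\mathrm{inter}}_G$, which is a connected $|E|$-regular graph whose vertex set is the set of acyclic orientations of $G$, and its stationary distribution is uniform: $\pi^{\mathrm{IR}}_O=1/|\chi_G(-1)|$ for every acyclic orientation $O$ of $G$.
   Context: Acyclic orientations $O$ of $G$ orient every edge with no directed cycle; $O[E]$ is the set of directed edges, $\le_O$ the partial order generated ($(x,y)\in O[E]\Rightarrow x<_O y$). For $\{u,v\}\in E$ with $(u,v)\in O[E]$, $O_{\{u,v\}}$ is the orientation obtained from $O$ by reversing every directed edge $(x,y)\in O[E]$ with $u\le_O x<_O y\le_O v$ and keeping all others. $\mathrm{AO}^{\mathrm{inter}}_G$ is the simple graph on the acyclic orientations of $G$ in which $O_1,O_2$ are adjacent iff $(O_1)_{\{u,v\}}=O_2$ for some $\{u,v\}\in E$. Interval-Reversal random walk: start from any acyclic orientation $O_0$; for $t\ge1$ choose $\{u,v\}\in E$ uniformly at random and set $O_t=(O_{t-1})_{\{u,v\}}$. $\chi_G$ is the chromatic polynomial of $G$, so $|\chi_G(-1)|$ is the number of acyclic orientations of $G$. A simple random walk on a graph moves at each step to a uniformly random neighbor. *)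

theory Defs
  imports "HOL-Probability.Probability" "HOL-Computational_Algebra.Polynomial"
begin

text \<open>Graphs are given by a vertex set and a set of two-element edges \<open>{u, v}\<close>.\<close>

definition simple_graph :: "'a set \<Rightarrow> 'a set set \<Rightarrow> bool" where
  "simple_graph V E \<longleftrightarrow> finite V \<and> (\<forall>e\<in>E. e \<subseteq> V \<and> card e = 2)"

definition neighbours :: "'a set set \<Rightarrow> 'a \<Rightarrow> 'a set" where
  "neighbours E x = {y. {x, y} \<in> E}"

definition connected_graph :: "'a set \<Rightarrow> 'a set set \<Rightarrow> bool" where
  "connected_graph V E \<longleftrightarrow>
     V \<noteq> {} \<and> (\<forall>x\<in>V. \<forall>y\<in>V. (x, y) \<in> {(a, b). {a, b} \<in> E}\<^sup>*)"

definition regular_graph :: "'a set \<Rightarrow> 'a set set \<Rightarrow> nat \<Rightarrow> bool" where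
  "regular_graph V E d \<longleftrightarrow> (\<forall>x\<in>V. card (neighbours E x) = d)"

definition proper_colourings :: "'a set \<Rightarrow> 'a set set \<Rightarrow> nat \<Rightarrow> ('a \<Rightarrow> nat) set" where
  "proper_colourings V E k =
     {c \<in> V \<rightarrow>\<^sub>E {..<k}. \<forall>u v. {u, v} \<in> E \<longrightarrow> c u \<noteq> c v}"

definition chromatic_poly :: "'a set \<Rightarrow> 'a set set \<Rightarrow> int poly" where
  "chromatic_poly V E =
     (THE p. \<forall>k::nat. poly p (int k) = int (card (proper_colourings V E k)))"

text \<open>An orientation is represented by its set of directed edges.  The order it generates
  is then \<open>D\<^sup>*\<close>, with strict part \<open>D\<^sup>+\<close> when \<open>D\<close> is acyclic.\<close>

definition orientation :: "'a set set \<Rightarrow> ('a \<times> 'a) set \<Rightarrow> bool" where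
  "orientation E D \<longleftrightarrow>
     (\<forall>(x, y)\<in>D. {x, y} \<in> E) \<and>
     (\<forall>x y. {x, y} \<in> E \<longrightarrow> ((x, y) \<in> D \<longleftrightarrow> (y, x) \<notin> D))"

definition acyclic_orientations :: "'a set set \<Rightarrow> ('a \<times> 'a) set set" where
  "acyclic_orientations E = {D. orientation E D \<and> acyclic D}"

definition interval_arcs :: "('a \<times> 'a) set \<Rightarrow> 'a set \<Rightarrow> ('a \<times> 'a) set" where
  "interval_arcs D e =
     {(x, y) \<in> D. \<exists>u v. e = {u, v} \<and> (u, v) \<in> D \<and>
        (u, x) \<in> D\<^sup>* \<and> (x, y) \<in> D\<^sup>+ \<and> (y, v) \<in> D\<^sup>*}"

definition interval_reversal :: "('a \<times> 'a) set \<Rightarrow> 'a set \<Rightarrow> ('a \<times> 'a) set" where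
  "interval_reversal D e = (D - interval_arcs D e) \<union> (interval_arcs D e)\<inverse>"

text \<open>Edge set of the interval-reversal graph on the vertex set \<open>acyclic_orientations E\<close>.\<close>

definition AO_inter_edges :: "'a set set \<Rightarrow> ('a \<times> 'a) set set set" where
  "AO_inter_edges E =
     {{D1, D2} | D1 D2. D1 \<in> acyclic_orientations E \<and> D2 \<in> acyclic_orientations E \<and>
        (\<exists>e\<in>E. interval_reversal D1 e = D2)}"

text \<open>\<open>pmf_of_set\<close> is unspecified on the empty set, so both walks stay put when there is
  nothing to choose from.\<close>

definition interval_reversal_step :: "'a set set \<Rightarrow> ('a \<times> 'a) set \<Rightarrow> ('a \<times> 'a) set pmf" where
  "interval_reversal_step E D =
     (if E = {} then return_pmf D else map_pmf (interval_reversal D) (pmf_of_set E))"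

definition simple_walk_step :: "'a set set \<Rightarrow> 'a \<Rightarrow> 'a pmf" where
  "simple_walk_step E x =
     (if neighbours E x = {} then return_pmf x else pmf_of_set (neighbours E x))"

text \<open>Joint law of the states at times \<open>0, \<dots>, t\<close> of the walk started at \<open>x\<close>.\<close>

primrec walk_law :: "('s \<Rightarrow> 's pmf) \<Rightarrow> 's \<Rightarrow> nat \<Rightarrow> 's list pmf" where
  "walk_law K x 0 = return_pmf [x]"
| "walk_law K x (Suc t) =
     bind_pmf (walk_law K x t) (\<lambda>w. map_pmf (\<lambda>y. w @ [y]) (K (last w)))"

definition stationary_distribution :: "'s set \<Rightarrow> ('s \<Rightarrow> 's pmf) \<Rightarrow> 's pmf \<Rightarrow> bool" where
  "stationary_distribution S K \<pi> \<longleftrightarrow> set_pmf \<pi> \<subseteq> S \<and> bind_pmf \<pi> K = \<pi>"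

end

theory Submission
  imports Defs
begin

text \<open>Fix an arc \<open>(u, v)\<close> of an acyclic orientation.  Assigning level 1 to the elements of the
  interval \<open>[u, v]\<close>, level 0 to the remaining elements below \<open>v\<close> and level 2 to all others is weakly
  monotone along the arcs, and stays so after the interval is reversed.  Hence the reversal is
  acyclic and has the same interval, with the roles of its ends exchanged, so it is an involution.
  The reversed arcs determine \<open>{u, v}\<close>, as \<open>u\<close> and \<open>v\<close> are the least and greatest of their ends;
  this gives regularity.  Connectedness uses only reversals of single covering arcs.
  Since every edge acts by an involution, the uniform distribution is stationary, and it is the only
  stationary one by the maximum principle.  The number of states is \<open>\<bar>\<chi>(- 1)\<bar>\<close> by Stanley's
  deletion-contraction argument: an acyclic orientation of \<open>G - uv\<close> extends to \<open>G\<close> in two ways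
  if it comes from \<open>G / uv\<close> and in one way otherwise.\<close>

section \<open>Interval reversal\<close>

definition order_interval :: "('a \<times> 'a) set \<Rightarrow> 'a \<Rightarrow> 'a \<Rightarrow> 'a set" where
  "order_interval D u v = {x. (u, x) \<in> D\<^sup>* \<and> (x, v) \<in> D\<^sup>*}"

definition interval_level :: "('a \<times> 'a) set \<Rightarrow> 'a \<Rightarrow> 'a \<Rightarrow> 'a \<Rightarrow> nat" where
  "interval_level D u v x = (if (x, v) \<notin> D\<^sup>* then 2 else if (u, x) \<in> D\<^sup>* then 1 else 0)"

lemma interval_level_eq_1_iff: "interval_level D u v x = 1 \<longleftrightarrow> x \<in> order_interval D u v"
  by (auto simp: interval_level_def order_interval_def)

text \<open>Lying below \<open>v\<close> passes from the head of an arc to its tail, lying above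
  \<open>u\<close> from the tail to the head.\<close>

lemma interval_level_mono:
  assumes "(x, y) \<in> D"
  shows "interval_level D u v x \<le> interval_level D u v y"
  using assms converse_rtrancl_into_rtrancl[of x y D v] rtrancl_into_rtrancl[of u x D y]
  by (auto simp: interval_level_def)

lemma acyclic_no_back_path:
  assumes "acyclic D" "(x, y) \<in> D\<^sup>+"
  shows "(y, x) \<notin> D\<^sup>*"
  using assms by (meson acyclic_def trancl_rtrancl_trancl)

lemma acyclic_rtrancl_antisym:
  assumes "acyclic D" "(x, y) \<in> D\<^sup>*" "(y, x) \<in> D\<^sup>*"
  shows "x = y"
  using assms acyclic_no_back_path by (metis rtranclD)

lemma acyclic_arc_asym:
  assumes "acyclic D" "(x, y) \<in> D"
  shows "(y, x) \<notin> D"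
  using acyclic_no_back_path[OF assms(1) r_into_trancl[OF assms(2)]] by auto

text \<open>Acyclicity rules out the arc \<open>(v, u)\<close>, so the unordered edge determines its
  ends; the path conditions then say that both ends of the arc lie in the interval.\<close>

lemma interval_arcs_eq:
  assumes "acyclic D" "(u, v) \<in> D"
  shows "interval_arcs D {u, v} = D \<inter> order_interval D u v \<times> order_interval D u v"
proof -
  have vu: "(v, u) \<notin> D"
    using acyclic_arc_asym[OF assms] .
  have "(\<exists>u' v'. {u, v} = {u', v'} \<and> (u', v') \<in> D \<and> P u' v') \<longleftrightarrow> P u v" for P
    using assms vu by (auto simp: doubleton_eq_iff)
  then have "interval_arcs D {u, v} =
      {(x, y) \<in> D. (u, x) \<in> D\<^sup>* \<and> (x, y) \<in> D\<^sup>+ \<and> (y, v) \<in> D\<^sup>*}"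
    unfolding interval_arcs_def by presburger
  then show ?thesis
    by (auto simp: order_interval_def intro: rtrancl_into_rtrancl converse_rtrancl_into_rtrancl)
qed

lemma interval_reversal_iff:
  assumes "acyclic D" "(u, v) \<in> D"
  shows "(x, y) \<in> interval_reversal D {u, v} \<longleftrightarrow>
    (if x \<in> order_interval D u v \<and> y \<in> order_interval D u v then (y, x) \<in> D else (x, y) \<in> D)"
  unfolding interval_reversal_def interval_arcs_eq[OF assms] by auto

text \<open>A reversed arc has both ends at level 1, and every other arc already belongs to
  \<open>D\<close>.\<close>

lemma interval_level_mono_reversal:
  assumes "acyclic D" "(u, v) \<in> D" "(x, y) \<in> interval_reversal D {u, v}"
  shows "interval_level D u v x \<le> interval_level D u v y"
  using assms interval_level_mono[of x y D u v]
  by (auto simp: interval_reversal_iff interval_level_eq_1_iff[symmetric] split: if_splits)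

lemma acyclic_interval_reversal:
  assumes "acyclic D" "(u, v) \<in> D"
  shows "acyclic (interval_reversal D {u, v})"
proof -
  let ?f = "interval_level D u v"
  \<comment> \<open>A strict order containing the reversal: levels are compared first, and ties are
    broken by paths of \<open>D\<close>, read backwards on level 1, where the arcs are reversed, and
    forwards elsewhere.\<close>
  define R where "R = {(x, y). ?f x < ?f y \<or>
    (?f x = ?f y \<and> (if ?f x = 1 then (y, x) \<in> D\<^sup>+ else (x, y) \<in> D\<^sup>+))}"
  have "trans R"
    unfolding R_def trans_def by (auto split: if_splits intro: trancl_trans)
  moreover have "irrefl R"
    using assms(1) by (auto simp: R_def irrefl_def acyclic_def)
  ultimately have "acyclic R"
    by (metis acyclic_irrefl trancl_id)
  moreover have "interval_reversal D {u, v} \<subseteq> R"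
  proof safe
    fix x y assume xy: "(x, y) \<in> interval_reversal D {u, v}"
    show "(x, y) \<in> R"
      using interval_level_mono_reversal[OF assms xy] xy
      unfolding interval_reversal_iff[OF assms] interval_level_eq_1_iff[symmetric] R_def
      by (auto split: if_splits)
  qed
  ultimately show ?thesis
    using acyclic_subset by blast
qed

section \<open>Reversal as an involution on acyclic orientations, injective in the edge\<close>

lemma orientationI:
  assumes "\<And>x y. (x, y) \<in> D \<Longrightarrow> {x, y} \<in> E" "\<And>x y. (x, y) \<in> D \<Longrightarrow> (y, x) \<notin> D"
    "\<And>x y. {x, y} \<in> E \<Longrightarrow> (x, y) \<in> D \<or> (y, x) \<in> D"
  shows "orientation E D"
  unfolding orientation_def using assms by blast

lemma orientationD:
  assumes "orientation E D"
  shows "(x, y) \<in> D \<Longrightarrow> {x, y} \<in> E" "(x, y) \<in> D \<Longrightarrow> (y, x) \<notin> D"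
    "{x, y} \<in> E \<Longrightarrow> (x, y) \<in> D \<or> (y, x) \<in> D"
  using assms by (auto simp: orientation_def)

lemma acyclic_orientation_arcE:
  assumes "simple_graph V E" "D \<in> acyclic_orientations E" "e \<in> E"
  obtains u v where "e = {u, v}" "(u, v) \<in> D" "u \<noteq> v" "acyclic D" "orientation E D"
proof -
  obtain a b where "e = {a, b}" "a \<noteq> b"
    using assms by (auto simp: simple_graph_def card_2_iff)
  moreover have D: "acyclic D" "orientation E D"
    using assms(2) by (simp_all add: acyclic_orientations_def)
  moreover have "(a, b) \<in> D \<or> (b, a) \<in> D"
    using D(2) assms(3) \<open>e = {a, b}\<close> unfolding orientation_def by blast
  ultimately show ?thesis
    using that[of a b] that[of b a] by (metis insert_commute)
qed

lemma interval_reversal_in_acyclic_orientations: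
  assumes "simple_graph V E" "D \<in> acyclic_orientations E" "e \<in> E"
  shows "interval_reversal D e \<in> acyclic_orientations E"
proof -
  obtain u v where e: "e = {u, v}" and uv: "(u, v) \<in> D" "acyclic D" "orientation E D"
    using acyclic_orientation_arcE[OF assms] .
  have arcs: "\<And>x y. (x, y) \<in> D \<Longrightarrow> {x, y} \<in> E"
    and one: "\<And>x y. {x, y} \<in> E \<Longrightarrow> (x, y) \<in> D \<longleftrightarrow> (y, x) \<notin> D"
    using uv(3) by (auto simp: orientation_def)
  have "orientation E (interval_reversal D e)"
    unfolding orientation_def e
  proof safe
    fix x y assume "(x, y) \<in> interval_reversal D {u, v}"
    then show "{x, y} \<in> E"
      using arcs[of x y] arcs[of y x] uv
      by (simp add: interval_reversal_iff insert_commute[of y x] split: if_splits)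
  next
    fix x y
    assume "{x, y} \<in> E" "(x, y) \<in> interval_reversal D {u, v}" "(y, x) \<in> interval_reversal D {u, v}"
    then show False
      using one[of x y] uv by (auto simp: interval_reversal_iff split: if_splits)
  next
    fix x y
    assume "{x, y} \<in> E" "(y, x) \<notin> interval_reversal D {u, v}"
    then show "(x, y) \<in> interval_reversal D {u, v}"
      using one[of x y] uv by (auto simp: interval_reversal_iff split: if_splits)
  qed
  then show ?thesis
    using acyclic_interval_reversal[OF uv(2,1)] e by (simp add: acyclic_orientations_def)
qed

text \<open>Intervals are convex: each vertex on the path lies above \<open>u\<close> and below
  \<open>v\<close>. Paths inside the interval are the ones that a reversal turns around.\<close>

lemma order_interval_path:
  assumes "(x, y) \<in> D\<^sup>*" "(u, x) \<in> D\<^sup>*" "(y, v) \<in> D\<^sup>*"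
  shows "(x, y) \<in> (D \<inter> order_interval D u v \<times> order_interval D u v)\<^sup>*"
  using assms
proof (induction rule: rtrancl_induct)
  case (step y z)
  then have "(y, v) \<in> D\<^sup>*" "(u, y) \<in> D\<^sup>*" "(u, z) \<in> D\<^sup>*"
    by (auto intro: converse_rtrancl_into_rtrancl rtrancl_trans rtrancl_into_rtrancl)
  with step show ?case
    by (auto simp: order_interval_def intro!: rtrancl_into_rtrancl[of x y])
qed auto

text \<open>One inclusion squeezes levels: \<open>u\<close> and \<open>v\<close> both have level 1,
  and levels never drop along paths of the new orientation. For the other, the old paths from
  \<open>u\<close> to \<open>x\<close> and from \<open>x\<close> to \<open>v\<close> run inside the
  interval and are turned around.\<close>

lemma order_interval_reversal:
  assumes "acyclic D" "(u, v) \<in> D"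
  shows "order_interval (interval_reversal D {u, v}) v u = order_interval D u v"
    (is "order_interval ?D' v u = ?I")
proof (intro set_eqI iffI)
  let ?f = "interval_level D u v"
  have mono: "?f x \<le> ?f y" if "(x, y) \<in> ?D'\<^sup>*" for x y
    using that
    by induction (auto dest: interval_level_mono_reversal[OF assms])
  have uv: "u \<in> ?I" "v \<in> ?I"
    using assms by (auto simp: order_interval_def)
  fix x
  {
    assume "x \<in> order_interval ?D' v u"
    then have "?f v \<le> ?f x" "?f x \<le> ?f u"
      using mono by (auto simp: order_interval_def)
    then show "x \<in> ?I"
      using uv by (simp add: interval_level_eq_1_iff[symmetric])
  }
  assume x: "x \<in> ?I"
  have sub: "(D \<inter> ?I \<times> ?I)\<inverse> \<subseteq> ?D'"
    using assms by (auto simp: interval_reversal_iff)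
  have "(u, x) \<in> (D \<inter> ?I \<times> ?I)\<^sup>*" "(x, v) \<in> (D \<inter> ?I \<times> ?I)\<^sup>*"
    using x order_interval_path[of u x D u v] order_interval_path[of x v D u v]
    by (auto simp: order_interval_def)
  then have "(x, u) \<in> ((D \<inter> ?I \<times> ?I)\<inverse>)\<^sup>*" "(v, x) \<in> ((D \<inter> ?I \<times> ?I)\<inverse>)\<^sup>*"
    by (simp_all only: rtrancl_converse converse_iff)
  then show "x \<in> order_interval ?D' v u"
    using rtrancl_mono[OF sub] by (auto simp: order_interval_def)
qed

lemma interval_reversal_involution:
  assumes "simple_graph V E" "D \<in> acyclic_orientations E" "e \<in> E"
  shows "interval_reversal (interval_reversal D e) e = D"
proof -
  obtain u v where e: "e = {u, v}" and uv: "(u, v) \<in> D" "acyclic D"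
    by (rule acyclic_orientation_arcE[OF assms])
  let ?D' = "interval_reversal D {u, v}"
  have D': "acyclic ?D'" "(v, u) \<in> ?D'"
    using uv acyclic_interval_reversal by (auto simp: interval_reversal_iff order_interval_def)
  have "(x, y) \<in> interval_reversal ?D' {v, u} \<longleftrightarrow> (x, y) \<in> D" for x y
    unfolding interval_reversal_iff[OF D'] order_interval_reversal[OF uv(2,1)]
      interval_reversal_iff[OF uv(2,1)] by auto
  then have "interval_reversal ?D' {v, u} = D"
    by (simp add: set_eq_iff)
  then show ?thesis
    by (metis e insert_commute)
qed

lemma inj_on_interval_reversal:
  assumes "simple_graph V E" "D \<in> acyclic_orientations E"
  shows "inj_on (interval_reversal D) E"
proof
  fix e e' assume ee: "e \<in> E" "e' \<in> E" "interval_reversal D e = interval_reversal D e'"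
  obtain u v where e: "e = {u, v}" "(u, v) \<in> D" and D: "acyclic D"
    by (rule acyclic_orientation_arcE[OF assms ee(1)])
  obtain u' v' where e': "e' = {u', v'}" "(u', v') \<in> D"
    by (rule acyclic_orientation_arcE[OF assms ee(2)])
  \<comment> \<open>The arcs lost in a reversal are exactly those inside the interval, as no arc of
    an acyclic \<open>D\<close> has its opposite in \<open>D\<close>.\<close>
  have rev: "(a, b) \<in> D - interval_reversal D {a', b'} \<longleftrightarrow>
      (a, b) \<in> D \<and> a \<in> order_interval D a' b' \<and> b \<in> order_interval D a' b'"
    if "(a', b') \<in> D" for a b a' b'
    using acyclic_no_back_path[OF D, of a b] that D by (auto simp: interval_reversal_iff)
  have "(u, v) \<in> D - interval_reversal D e" "(u', v') \<in> D - interval_reversal D e'"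
    unfolding e(1) e'(1) rev[OF e(2)] rev[OF e'(2)] using e e' by (auto simp: order_interval_def)
  then have "(u, v) \<in> D - interval_reversal D e'" "(u', v') \<in> D - interval_reversal D e"
    using ee(3) by simp_all
  \<comment> \<open>Each of the two chosen arcs is lost in the reversal at the other edge, hence
    lies in the other interval; antisymmetry then identifies the ends.\<close>
  then have "u \<in> order_interval D u' v'" "v \<in> order_interval D u' v'"
    "u' \<in> order_interval D u v" "v' \<in> order_interval D u v"
    unfolding e(1) e'(1) rev[OF e(2)] rev[OF e'(2)]
    by simp_all
  then have "u = u'" "v = v'"
    using acyclic_rtrancl_antisym[OF D, of u u'] acyclic_rtrancl_antisym[OF D, of v v']
    by (simp_all add: order_interval_def)
  then show "e = e'"
    using e e' by simp
qed

text \<open>The arc of the chosen edge is itself reversed; this excludes loops in the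
  interval-reversal graph.\<close>

lemma interval_reversal_neq:
  assumes "simple_graph V E" "D \<in> acyclic_orientations E" "e \<in> E"
  shows "interval_reversal D e \<noteq> D"
proof -
  obtain u v where e: "e = {u, v}" "(u, v) \<in> D" and D: "acyclic D"
    by (rule acyclic_orientation_arcE[OF assms])
  then have "(v, u) \<in> interval_reversal D e"
    by (auto simp: interval_reversal_iff order_interval_def)
  moreover have "(v, u) \<notin> D"
    using e D acyclic_no_back_path by fast
  ultimately show ?thesis
    by auto
qed

section \<open>The interval-reversal graph\<close>

lemma finite_acyclic_orientations:
  assumes "simple_graph V E"
  shows "finite (acyclic_orientations E)"
proof (rule finite_subset)
  show "acyclic_orientations E \<subseteq> Pow (V \<times> V)"
    using assms by (fastforce simp: acyclic_orientations_def orientation_def simple_graph_def)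
  show "finite (Pow (V \<times> V))"
    using assms by (simp add: simple_graph_def)
qed

lemma finite_edges: "simple_graph V E \<Longrightarrow> finite E"
  by (rule finite_subset[of _ "Pow V"]) (auto simp: simple_graph_def)

text \<open>Orienting every edge towards the larger value of an injective numbering of
  \<open>V\<close> creates no cycle.\<close>

lemma acyclic_orientations_nonempty:
  assumes "simple_graph V E"
  shows "acyclic_orientations E \<noteq> {}"
proof -
  obtain f :: "'a \<Rightarrow> nat" where f: "inj_on f V"
    using assms finite_imp_inj_to_nat_seg unfolding simple_graph_def by metis
  let ?D = "{(x, y). {x, y} \<in> E \<and> f x < f y}"
  have "acyclic ?D"
    by (rule acyclic_subset[OF wf_acyclic[OF wf_measure[of f]]]) auto
  moreover have ne: "f x \<noteq> f y" if "{x, y} \<in> E" for x y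
    using assms that f by (fastforce simp: simple_graph_def inj_on_def)
  have "orientation E ?D"
    unfolding orientation_def
  proof (intro conjI allI impI)
    fix x y assume "{x, y} \<in> E"
    with ne[OF this] show "((x, y) \<in> ?D) = ((y, x) \<notin> ?D)"
      by (simp add: insert_commute[of y x] neq_iff) linarith
  qed auto
  ultimately show ?thesis
    by (auto simp: acyclic_orientations_def)
qed

lemma simple_graph_AO_inter:
  assumes "simple_graph V E"
  shows "simple_graph (acyclic_orientations E) (AO_inter_edges E)"
  using finite_acyclic_orientations[OF assms] interval_reversal_neq[OF assms]
  by (fastforce simp: simple_graph_def AO_inter_edges_def card_2_iff)

text \<open>An edge of this graph is unordered, whereas a reversal leads from one orientation to
  another; since reversals are involutions, both readings of the edge give the same
  neighbours.\<close>

lemma neighbours_AO_inter: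
  assumes "simple_graph V E" "D \<in> acyclic_orientations E"
  shows "neighbours (AO_inter_edges E) D = interval_reversal D ` E"
proof (intro set_eqI iffI)
  fix D' assume "D' \<in> neighbours (AO_inter_edges E) D"
  then show "D' \<in> interval_reversal D ` E"
    using interval_reversal_involution[OF assms(1)]
    by (fastforce simp: neighbours_def AO_inter_edges_def doubleton_eq_iff)
next
  fix D' assume "D' \<in> interval_reversal D ` E"
  then show "D' \<in> neighbours (AO_inter_edges E) D"
    using interval_reversal_in_acyclic_orientations[OF assms] assms
    by (auto simp: neighbours_def AO_inter_edges_def)
qed

lemma regular_AO_inter:
  assumes "simple_graph V E"
  shows "regular_graph (acyclic_orientations E) (AO_inter_edges E) (card E)"
  using neighbours_AO_inter[OF assms] inj_on_interval_reversal[OF assms]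
  by (simp add: regular_graph_def card_image)

section \<open>Connectedness of the interval-reversal graph\<close>

lemma rtrancl_avoiding_arc:
  assumes "(x, y) \<in> D\<^sup>*" "\<not> ((x, u) \<in> D\<^sup>* \<and> (v, y) \<in> D\<^sup>*)"
  shows "(x, y) \<in> (D - {(u, v)})\<^sup>*"
  using assms
proof (induction rule: rtrancl_induct)
  case (step y z)
  \<comment> \<open>A path from \<open>v\<close> to \<open>y\<close> would extend to
    \<open>z\<close>, so the condition passes back to \<open>y\<close>; and if the last arc were
    \<open>(u, v)\<close>, then \<open>x\<close> would reach \<open>u\<close> and \<open>z\<close>
    would be \<open>v\<close>.\<close>
  then have "\<not> ((x, u) \<in> D\<^sup>* \<and> (v, y) \<in> D\<^sup>*)" "(y, z) \<noteq> (u, v)"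
    by (auto intro: rtrancl_into_rtrancl)
  with step show ?case
    by (auto intro: rtrancl_into_rtrancl)
qed auto

text \<open>An arc of \<open>D\<close> on which \<open>D\<close> and \<open>D'\<close> disagree and whose interval is minimal must be a
  covering pair, for otherwise the rest of its interval would force its direction in \<open>D'\<close>.\<close>

lemma ex_covering_disagreement:
  assumes G: "simple_graph V E"
    and D: "D \<in> acyclic_orientations E" and D': "D' \<in> acyclic_orientations E" and ne: "D \<noteq> D'"
  obtains u v where "(u, v) \<in> D" "(u, v) \<notin> D'" "interval_arcs D {u, v} = {(u, v)}"
proof -
  have o: "orientation E D" "acyclic D" "orientation E D'" "acyclic D'"
    using D D' by (auto simp: acyclic_orientations_def)
  have "\<not> D \<subseteq> D'"
  proof
    assume "D \<subseteq> D'"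
    moreover have "D' \<subseteq> D"
    proof safe
      fix x y assume xy: "(x, y) \<in> D'"
      then have "{x, y} \<in> E" "(y, x) \<notin> D'"
        using o by (auto simp: orientation_def)
      then show "(x, y) \<in> D"
        using o(1) \<open>D \<subseteq> D'\<close> unfolding orientation_def by blast
    qed
    ultimately show False using ne by auto
  qed
  then have ex: "\<exists>a. a \<in> D - D'" by blast
  define m where "m = (\<lambda>(x, y). card (order_interval D x y))"
  obtain u v where uv: "(u, v) \<in> D - D'"
    and min: "\<And>b. b \<in> D - D' \<Longrightarrow> m (u, v) \<le> m b"
    using ex_has_least_nat[of "\<lambda>a. a \<in> D - D'" _ m] ex by (metis surj_pair)
  have fin: "finite (order_interval D u v)"
  proof (rule finite_subset)
    have "x = u \<or> x \<in> V" if "(u, x) \<in> D\<^sup>*" for x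
      using that
    proof cases
      case (step y)
      then have "{y, x} \<in> E" using o by (auto simp: orientation_def)
      then show ?thesis using G by (auto simp: simple_graph_def)
    qed auto
    then show "order_interval D u v \<subseteq> insert u V"
      by (auto simp: order_interval_def)
    show "finite (insert u V)" using G by (simp add: simple_graph_def)
  qed
  let ?I = "order_interval D u v"
  \<comment> \<open>By minimality, an arc of the interval on which \<open>D'\<close> disagrees would
    span the whole interval and thus have the ends \<open>u\<close> and \<open>v\<close>.\<close>
  have in_D': "(a, b) \<in> D'" if "(a, b) \<in> D" "a \<in> ?I" "b \<in> ?I" "(a, b) \<noteq> (u, v)" for a b
  proof (rule ccontr)
    assume "(a, b) \<notin> D'"
    then have le: "card ?I \<le> card (order_interval D a b)"
      using min[of "(a, b)"] that by (simp add: m_def)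
    have sub: "order_interval D a b \<subseteq> ?I"
      using that by (auto simp: order_interval_def intro: rtrancl_trans)
    then have "order_interval D a b = ?I"
      using le fin by (simp add: card_seteq)
    then have "u \<in> order_interval D a b" "v \<in> order_interval D a b"
      using uv by (auto simp: order_interval_def)
    then have "a = u" "b = v"
      using that acyclic_rtrancl_antisym[OF o(2), of a u] acyclic_rtrancl_antisym[OF o(2), of b v]
      by (simp_all add: order_interval_def)
    then show False using that by simp
  qed
  have "interval_arcs D {u, v} = {(u, v)}"
  proof (rule ccontr)
    assume "interval_arcs D {u, v} \<noteq> {(u, v)}"
    moreover have "(u, v) \<in> interval_arcs D {u, v}"
      using uv o by (auto simp: interval_arcs_eq order_interval_def)
    ultimately obtain x y where "(x, y) \<in> interval_arcs D {u, v}" and xyne: "(x, y) \<noteq> (u, v)"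
      by auto
    then have xy: "(x, y) \<in> D" "x \<in> ?I" "y \<in> ?I"
      using uv o by (auto simp: interval_arcs_eq)
    let ?J = "D \<inter> ?I \<times> ?I"
    have J: "?J\<^sup>* \<subseteq> D\<^sup>*" by (rule rtrancl_mono) auto
    \<comment> \<open>Either path would close a cycle through \<open>(x, y)\<close>. Hence paths
      from \<open>u\<close> to \<open>x\<close> and from \<open>y\<close> to \<open>v\<close> cannot
      use the arc \<open>(u, v)\<close>, and inside the interval all their arcs belong to
      \<open>D'\<close>.\<close>
    have xv: "\<not> (v, x) \<in> D\<^sup>*" "\<not> (y, u) \<in> D\<^sup>*"
      using acyclic_no_back_path[OF o(2), of x y] xy
      by (auto simp: order_interval_def intro: rtrancl_trans)
    have "(u, x) \<in> (?J - {(u, v)})\<^sup>*" "(y, v) \<in> (?J - {(u, v)})\<^sup>*"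
      using xv J order_interval_path[of u x D u v] order_interval_path[of y v D u v] xy(2,3)
      by (auto intro!: rtrancl_avoiding_arc simp: order_interval_def)
    moreover have "?J - {(u, v)} \<subseteq> D'"
      using in_D' by auto
    ultimately have "(u, x) \<in> D'\<^sup>*" "(y, v) \<in> D'\<^sup>*"
      using rtrancl_mono by blast+
    moreover have "(x, y) \<in> D'" using in_D' xy xyne by auto
    \<comment> \<open>The detour through \<open>(x, y)\<close> survives in \<open>D'\<close>, where
      the edge \<open>{u, v}\<close> points the other way: a cycle.\<close>
    ultimately have "(u, v) \<in> D'\<^sup>+"
      by (meson rtrancl_into_trancl1 trancl_rtrancl_trancl)
    moreover have "(v, u) \<in> D'"
      using uv o by (auto simp: orientation_def)
    ultimately show False
      using o acyclic_no_back_path by fast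
  qed
  then show ?thesis
    using that uv by auto
qed

text \<open>Reversing a covering arc changes this arc alone. Choosing one on which \<open>D\<close>
  disagrees with the target \<open>D'\<close> removes one disagreement and creates none, so the
  number of arcs of \<open>D\<close> outside \<open>D'\<close> drops.\<close>

lemma connected_AO_inter:
  assumes G: "simple_graph V E"
  shows "connected_graph (acyclic_orientations E) (AO_inter_edges E)"
proof -
  have "(D, D') \<in> {(a, b). {a, b} \<in> AO_inter_edges E}\<^sup>*"
    if D: "D \<in> acyclic_orientations E" and D': "D' \<in> acyclic_orientations E" for D D'
    using D
  proof (induction "card (D - D')" arbitrary: D rule: less_induct)
    case less
    show ?case
    proof (cases "D = D'")
      case False
      obtain u v where uv: "(u, v) \<in> D" "(u, v) \<notin> D'" "interval_arcs D {u, v} = {(u, v)}"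
        using ex_covering_disagreement[OF G less.prems D' False] .
      let ?D = "interval_reversal D {u, v}"
      have D_eq: "?D = D - {(u, v)} \<union> {(v, u)}"
        unfolding interval_reversal_def uv(3) by auto
      have e: "{u, v} \<in> E"
        using uv less.prems by (auto simp: acyclic_orientations_def orientation_def)
      have "(v, u) \<in> D'"
        using uv e D' by (auto simp: acyclic_orientations_def orientation_def)
      then have "?D - D' \<subset> D - D'"
        using uv by (auto simp: D_eq)
      moreover have "finite D"
        using less.prems G
        by (intro finite_subset[of D "V \<times> V"])
          (fastforce simp: acyclic_orientations_def orientation_def simple_graph_def)+
      ultimately have "card (?D - D') < card (D - D')"
        by (simp add: psubset_card_mono)
      moreover have D2: "?D \<in> acyclic_orientations E"
        using interval_reversal_in_acyclic_orientations[OF G less.prems e] .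
      ultimately have "(?D, D') \<in> {(a, b). {a, b} \<in> AO_inter_edges E}\<^sup>*"
        using less.hyps by blast
      moreover have "{D, ?D} \<in> AO_inter_edges E"
        using D2 e less.prems by (auto simp: AO_inter_edges_def)
      ultimately show ?thesis
        by (auto intro: converse_rtrancl_into_rtrancl)
    qed auto
  qed
  then show ?thesis
    using acyclic_orientations_nonempty[OF G] by (auto simp: connected_graph_def)
qed

section \<open>Deletion and contraction\<close>

definition merge_vertex :: "'a \<Rightarrow> 'a \<Rightarrow> 'a \<Rightarrow> 'a" where
  "merge_vertex u v x = (if x = v then u else x)"

text \<open>Edges that become parallel coincide, as the result is a set. The edge
  \<open>{u, v}\<close> is to be deleted first, since its image is a singleton.\<close>

definition contract_edges :: "'a set set \<Rightarrow> 'a \<Rightarrow> 'a \<Rightarrow> 'a set set" where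
  "contract_edges E u v = (`) (merge_vertex u v) ` E"

lemma simple_graph_delete: "simple_graph V E \<Longrightarrow> simple_graph V (E - {e})"
  by (auto simp: simple_graph_def)

lemma merge_vertex_eq_iff:
  "merge_vertex u v x = merge_vertex u v y \<longleftrightarrow> x = y \<or> (x \<in> {u, v} \<and> y \<in> {u, v})"
  by (auto simp: merge_vertex_def)

lemma contract_edges_iff:
  assumes "simple_graph V E"
  shows "{a, b} \<in> contract_edges E u v \<longleftrightarrow>
    (\<exists>x y. {x, y} \<in> E \<and> merge_vertex u v x = a \<and> merge_vertex u v y = b)"
proof
  assume "{a, b} \<in> contract_edges E u v"
  then obtain e where e: "e \<in> E" "{a, b} = merge_vertex u v ` e"
    by (auto simp: contract_edges_def)
  then obtain x y where xy: "e = {x, y}"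
    using assms by (auto simp: simple_graph_def card_2_iff)
  have "{x, y} \<in> E" "{y, x} \<in> E"
    using e xy by (auto simp: insert_commute[of y x])
  moreover have "{a, b} = {merge_vertex u v x, merge_vertex u v y}"
    using e xy by simp
  ultimately show "\<exists>x y. {x, y} \<in> E \<and> merge_vertex u v x = a \<and> merge_vertex u v y = b"
    by (metis doubleton_eq_iff)
next
  assume "\<exists>x y. {x, y} \<in> E \<and> merge_vertex u v x = a \<and> merge_vertex u v y = b"
  then obtain x y where "{x, y} \<in> E" "{a, b} = merge_vertex u v ` {x, y}"
    by auto
  then show "{a, b} \<in> contract_edges E u v"
    unfolding contract_edges_def by (rule image_eqI[rotated])
qed

lemma simple_graph_contract:
  assumes G: "simple_graph V E" and u: "u \<in> V" "u \<noteq> v" and uv: "{u, v} \<notin> E"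
  shows "simple_graph (V - {v}) (contract_edges E u v)"
  unfolding simple_graph_def
proof (intro conjI ballI)
  show "finite (V - {v})" using G by (simp add: simple_graph_def)
  fix e' assume "e' \<in> contract_edges E u v"
  then obtain e where e: "e \<in> E" "e' = merge_vertex u v ` e"
    by (auto simp: contract_edges_def)
  then have eV: "e \<subseteq> V" "card e = 2"
    using G by (auto simp: simple_graph_def)
  show "e' \<subseteq> V - {v}"
    using e eV u by (auto simp: merge_vertex_def)
  obtain x y where xy: "e = {x, y}" "x \<noteq> y"
    using eV by (auto simp: card_2_iff)
  have "merge_vertex u v x \<noteq> merge_vertex u v y"
    using xy e uv by (auto simp: merge_vertex_eq_iff insert_commute[of v u])
  then show "card e' = 2"
    using e xy by simp
qed

section \<open>Proper colourings under deletion and contraction\<close>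

lemma finite_proper_colourings:
  assumes "simple_graph V E"
  shows "finite (proper_colourings V E k)"
  by (rule finite_subset[of _ "V \<rightarrow>\<^sub>E {..<k}"])
    (use assms in \<open>auto simp: proper_colourings_def simple_graph_def intro: finite_PiE\<close>)

text \<open>A colouring with equal values at \<open>u\<close> and \<open>v\<close> factors through
  \<open>merge_vertex u v\<close>, so restriction to \<open>V - {v}\<close> and composition with the
  merging map are mutually inverse.\<close>

lemma card_proper_colourings_contract:
  assumes G: "simple_graph V E" and uV: "u \<in> V" "v \<in> V" "u \<noteq> v"
  shows "card {c \<in> proper_colourings V E k. c u = c v} =
    card (proper_colourings (V - {v}) (contract_edges E u v) k)"
proof (rule bij_betw_same_card)
  let ?m = "merge_vertex u v"
  let ?A = "{c \<in> proper_colourings V E k. c u = c v}"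
  let ?B = "proper_colourings (V - {v}) (contract_edges E u v) k"
  let ?f = "\<lambda>c. restrict c (V - {v})" and ?g = "\<lambda>c. restrict (c \<circ> ?m) V"
  have EV: "x \<in> V" "y \<in> V" if "{x, y} \<in> E" for x y
    using that G by (auto simp: simple_graph_def)
  have mV: "?m x \<in> V - {v}" if "x \<in> V" for x
    using that uV by (auto simp: merge_vertex_def)
  show "bij_betw ?f ?A ?B"
  proof (rule bij_betwI)
    show "?f \<in> ?A \<rightarrow> ?B"
    proof
      fix c assume c: "c \<in> ?A"
      then have cm: "c (?m x) = c x" for x
        by (auto simp: merge_vertex_def)
      have "c a \<noteq> c b" if ab: "{a, b} \<in> contract_edges E u v" for a b
      proof -
        obtain x y where "{x, y} \<in> E" "?m x = a" "?m y = b"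
          using ab unfolding contract_edges_iff[OF G] by auto
        then show ?thesis using c cm by (auto simp: proper_colourings_def)
      qed
      moreover have "a \<in> V - {v} \<and> b \<in> V - {v}" if "{a, b} \<in> contract_edges E u v" for a b
        using that mV EV unfolding contract_edges_iff[OF G] by blast
      ultimately show "?f c \<in> ?B"
        using c by (auto simp: proper_colourings_def)
    qed
    show "?g \<in> ?B \<rightarrow> ?A"
    proof
      fix c assume c: "c \<in> ?B"
      have ne: "c (?m x) \<noteq> c (?m y)" if "{x, y} \<in> E" for x y
        using c that contract_edges_iff[OF G, of "?m x" "?m y" u v]
        by (auto simp: proper_colourings_def)
      have "?g c x \<noteq> ?g c y" if "{x, y} \<in> E" for x y
        using ne[OF that] EV[OF that] by simp
      moreover have "?g c \<in> V \<rightarrow>\<^sub>E {..<k}"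
        using c mV unfolding proper_colourings_def by (auto simp: PiE_iff)
      moreover have "?g c u = ?g c v"
        using uV by (simp add: merge_vertex_def)
      ultimately show "?g c \<in> ?A"
        by (simp add: proper_colourings_def)
    qed
    show "?g (?f c) = c" if "c \<in> ?A" for c
    proof
      fix x
      show "?g (?f c) x = c x"
        using that uV mV by (cases "x \<in> V")
          (auto simp: proper_colourings_def merge_vertex_def PiE_iff extensional_def)
    qed
    show "?f (?g c) = c" if "c \<in> ?B" for c
    proof
      fix x
      show "?f (?g c) x = c x"
        using PiE_arb[of c "V - {v}" "\<lambda>_. {..<k}" x] that
        by (cases "x \<in> V - {v}")
          (simp_all add: proper_colourings_def merge_vertex_def restrict_def, blast)
    qed
  qed
qed

text \<open>Restoring the edge \<open>{u, v}\<close> forbids precisely the colourings with equal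
  values at its ends.\<close>

lemma card_proper_colourings_delete:
  assumes G: "simple_graph V E" and uv: "{u, v} \<in> E"
  shows "card (proper_colourings V (E - {{u, v}}) k) =
    card (proper_colourings V E k) +
    card {c \<in> proper_colourings V (E - {{u, v}}) k. c u = c v}"
proof -
  have "proper_colourings V (E - {{u, v}}) k =
    proper_colourings V E k \<union> {c \<in> proper_colourings V (E - {{u, v}}) k. c u = c v}"
    using uv by (auto simp: proper_colourings_def) (metis doubleton_eq_iff)
  moreover have "proper_colourings V E k \<inter>
      {c \<in> proper_colourings V (E - {{u, v}}) k. c u = c v} = {}"
    using uv by (auto simp: proper_colourings_def)
  moreover have "finite (proper_colourings V E k)"
    "finite (proper_colourings V (E - {{u, v}}) k)"
    using G simple_graph_delete finite_proper_colourings by blast+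
  ultimately show ?thesis
    by (metis (no_types, lifting) card_Un_disjoint finite_Un)
qed

section \<open>Acyclic orientations under deletion and contraction\<close>

lemma acyclic_merge:
  assumes D: "acyclic D" and uv: "(u, v) \<notin> D\<^sup>*" "(v, u) \<notin> D\<^sup>*"
  shows "acyclic (map_prod (merge_vertex u v) (merge_vertex u v) ` D)"
proof -
  let ?m = "merge_vertex u v" and ?D = "map_prod (merge_vertex u v) (merge_vertex u v) ` D"
  have no: "(w, w') \<notin> D\<^sup>+" if "w \<in> {u, v}" "w' \<in> {u, v}" for w w'
    using that uv D by (auto simp: acyclic_def dest: trancl_into_rtrancl)
  \<comment> \<open>A path of the merged relation lifts to a path of \<open>D\<close> with at most
    one jump inside \<open>{u, v}\<close>: between two jumps there would be a path of
    \<open>D\<close> with both ends in \<open>{u, v}\<close>, which \<open>no\<close>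
    forbids.\<close>
  have path: "\<exists>x y. ?m x = a \<and> ?m y = b \<and>
      ((x, y) \<in> D\<^sup>+ \<or> (\<exists>w\<in>{u, v}. \<exists>w'\<in>{u, v}. (x, w) \<in> D\<^sup>+ \<and> (w', y) \<in> D\<^sup>+))"
    if "(a, b) \<in> ?D\<^sup>+" for a b
    using that
  proof (induction rule: trancl_induct)
    case (base b)
    then show ?case by auto
  next
    case (step b c)
    then obtain y' z where z: "(y', z) \<in> D" "?m y' = b" "?m z = c"
      by auto
    obtain x y where x: "?m x = a" and y: "?m y = b"
      and or: "(x, y) \<in> D\<^sup>+ \<or> (\<exists>w\<in>{u, v}. \<exists>w'\<in>{u, v}. (x, w) \<in> D\<^sup>+ \<and> (w', y) \<in> D\<^sup>+)"
      using step.IH by blast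
    have "y' = y \<or> (y \<in> {u, v} \<and> y' \<in> {u, v})"
      using y z(2) merge_vertex_eq_iff by metis
    then have "(x, z) \<in> D\<^sup>+ \<or> (\<exists>w\<in>{u, v}. \<exists>w'\<in>{u, v}. (x, w) \<in> D\<^sup>+ \<and> (w', z) \<in> D\<^sup>+)"
    proof
      assume "y' = y"
      then show ?thesis
        using or z(1) trancl_into_trancl by metis
    next
      assume yy: "y \<in> {u, v} \<and> y' \<in> {u, v}"
      then have "(x, y) \<in> D\<^sup>+"
        using or no by blast
      then show ?thesis
        using yy z(1) by blast
    qed
    then show ?case
      using x z(3) by blast
  qed
  show ?thesis
    unfolding acyclic_def
  proof (intro allI notI)
    fix a assume "(a, a) \<in> ?D\<^sup>+"
    then obtain x y where xy: "?m x = ?m y"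
      and or: "(x, y) \<in> D\<^sup>+ \<or> (\<exists>w\<in>{u, v}. \<exists>w'\<in>{u, v}. (x, w) \<in> D\<^sup>+ \<and> (w', y) \<in> D\<^sup>+)"
      using path by metis
    from xy consider "x = y" | "x \<in> {u, v}" "y \<in> {u, v}"
      using merge_vertex_eq_iff by metis
    then show False
    proof cases
      case 1
      \<comment> \<open>A closed path with a jump, read from behind the jump, is a path of
        \<open>D\<close> between elements of \<open>{u, v}\<close>.\<close>
      then show False
        using or no D by (meson acyclic_def trancl_trans)
    next
      case 2
      then show False
        using or no by blast
    qed
  qed
qed

text \<open>Merging keeps the arcs acyclic because \<open>u\<close> and \<open>v\<close> are
  incomparable. Conversely, an acyclic orientation of the contraction pulls back along the merging
  map, and a path between \<open>u\<close> and \<open>v\<close> in the pullback would map to a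
  closed path.\<close>

lemma card_acyclic_orientations_contract:
  assumes G: "simple_graph V E" and u: "u \<in> V" "u \<noteq> v" and uv: "{u, v} \<notin> E"
  shows "card {D \<in> acyclic_orientations E. (u, v) \<notin> D\<^sup>* \<and> (v, u) \<notin> D\<^sup>*} =
    card (acyclic_orientations (contract_edges E u v))"
proof (rule bij_betw_same_card)
  let ?m = "merge_vertex u v"
  let ?A = "{D \<in> acyclic_orientations E. (u, v) \<notin> D\<^sup>* \<and> (v, u) \<notin> D\<^sup>*}"
  let ?B = "acyclic_orientations (contract_edges E u v)"
  let ?h = "\<lambda>D. map_prod ?m ?m ` D" and ?g = "\<lambda>D. {(x, y). {x, y} \<in> E \<and> (?m x, ?m y) \<in> D}"
  have mE: "{?m x, ?m y} \<in> contract_edges E u v" if "{x, y} \<in> E" for x y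
    using that contract_edges_iff[OF G] by blast
  have A: "{x, y} \<in> E" "(y, x) \<notin> D" if "D \<in> ?A" "(x, y) \<in> D" for D x y
    using that by (auto simp: acyclic_orientations_def orientation_def)
  have A': "(x, y) \<in> D \<or> (y, x) \<in> D" if "D \<in> ?A" "{x, y} \<in> E" for D x y
    using that unfolding acyclic_orientations_def orientation_def by blast
  have acyc: "acyclic (?h D)" if "D \<in> ?A" for D
    using that by (intro acyclic_merge) (auto simp: acyclic_orientations_def)
  show "bij_betw ?h ?A ?B"
  proof (rule bij_betwI)
    show "?h \<in> ?A \<rightarrow> ?B"
    proof
      fix D assume D: "D \<in> ?A"
      have "orientation (contract_edges E u v) (?h D)"
        unfolding orientation_def
      proof (intro conjI allI impI ballI)
        fix p assume "p \<in> ?h D"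
        then show "case p of (a, b) \<Rightarrow> {a, b} \<in> contract_edges E u v"
          using A(1)[OF D] mE by auto
      next
        fix a b assume "{a, b} \<in> contract_edges E u v"
        then obtain x y where xy: "{x, y} \<in> E" "?m x = a" "?m y = b"
          using contract_edges_iff[OF G] by metis
        then have "(a, b) \<in> ?h D \<or> (b, a) \<in> ?h D"
          using A'[OF D xy(1)] by (metis map_prod_imageI)
        \<comment> \<open>Edges identified by merging cannot receive opposite arcs, as these would
          form a cycle of length two.\<close>
        moreover have "\<not> ((a, b) \<in> ?h D \<and> (b, a) \<in> ?h D)"
          using acyclic_arc_asym[OF acyc[OF D], of a b] by simp
        ultimately show "((a, b) \<in> ?h D) = ((b, a) \<notin> ?h D)"
          by argo
      qed
      then show "?h D \<in> ?B"
        using acyc[OF D] by (simp add: acyclic_orientations_def)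
    qed
    show "?g \<in> ?B \<rightarrow> ?A"
    proof
      fix D assume "D \<in> ?B"
      then have D: "acyclic D" "orientation (contract_edges E u v) D"
        by (simp_all add: acyclic_orientations_def)
      have path: "(?m x, ?m y) \<in> D\<^sup>+" if "(x, y) \<in> (?g D)\<^sup>+" for x y
        using that by (induction rule: trancl_induct) (auto intro: trancl_into_trancl)
      have "acyclic (?g D)"
        using D(1) path unfolding acyclic_def by blast
      moreover have "(u, v) \<notin> (?g D)\<^sup>*" "(v, u) \<notin> (?g D)\<^sup>*"
        using D(1) path[of u v] path[of v u] u merge_vertex_eq_iff[of u v u v]
        unfolding rtrancl_eq_or_trancl acyclic_def by auto
      moreover have "orientation E (?g D)"
        unfolding orientation_def
      proof (intro conjI allI impI)
        fix x y assume xy: "{x, y} \<in> E"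
        then have "(?m x, ?m y) \<in> D \<longleftrightarrow> (?m y, ?m x) \<notin> D"
          using D(2) mE[OF xy] unfolding orientation_def by blast
        then show "((x, y) \<in> ?g D) = ((y, x) \<notin> ?g D)"
          using xy by (simp add: insert_commute[of y x])
      qed auto
      ultimately show "?g D \<in> ?A"
        by (simp add: acyclic_orientations_def)
    qed
    show "?g (?h D) = D" if D: "D \<in> ?A" for D
    proof (intro subset_antisym subrelI)
      fix x y assume "(x, y) \<in> ?g (?h D)"
      then have xy: "{x, y} \<in> E" "(?m x, ?m y) \<in> ?h D"
        by simp_all
      have "(?m y, ?m x) \<notin> ?h D"
        using acyclic_arc_asym[OF acyc[OF D] xy(2)] .
      then have "(y, x) \<notin> D"
        by (metis map_prod_imageI)
      then show "(x, y) \<in> D"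
        using A'[OF D xy(1)] by blast
    next
      fix x y assume "(x, y) \<in> D"
      then show "(x, y) \<in> ?g (?h D)"
        using A(1)[OF D] by (auto intro: map_prod_imageI)
    qed
    show "?h (?g D) = D" if D: "D \<in> ?B" for D
    proof
      show "?h (?g D) \<subseteq> D" by auto
      show "D \<subseteq> ?h (?g D)"
      proof safe
        fix a b assume ab: "(a, b) \<in> D"
        then have "{a, b} \<in> contract_edges E u v"
          using D by (auto simp: acyclic_orientations_def orientation_def)
        then obtain x y where "{x, y} \<in> E" "?m x = a" "?m y = b"
          using contract_edges_iff[OF G] by metis
        then show "(a, b) \<in> ?h (?g D)"
          using ab by (intro image_eqI[of _ _ "(x, y)"]) auto
      qed
    qed
  qed
qed

text \<open>Inserting the arc \<open>(u, v)\<close> closes a cycle precisely when a path already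
  leads from \<open>v\<close> to \<open>u\<close>.\<close>

lemma card_acyclic_orientations_arc:
  assumes e: "{u, v} \<in> E" "u \<noteq> v"
  shows "card {D \<in> acyclic_orientations E. (u, v) \<in> D} =
    card {D \<in> acyclic_orientations (E - {{u, v}}). (v, u) \<notin> D\<^sup>*}"
proof (rule bij_betw_same_card)
  let ?A = "{D \<in> acyclic_orientations E. (u, v) \<in> D}"
  let ?B = "{D \<in> acyclic_orientations (E - {{u, v}}). (v, u) \<notin> D\<^sup>*}"
  show "bij_betw (\<lambda>D. D - {(u, v)}) ?A ?B"
  proof (rule bij_betwI)
    show "(\<lambda>D. D - {(u, v)}) \<in> ?A \<rightarrow> ?B"
    proof
      fix D assume D: "D \<in> ?A"
      then have o: "acyclic D" "orientation E D" "(u, v) \<in> D" "(v, u) \<notin> D"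
        using e by (auto simp: acyclic_orientations_def orientation_def)
      have "(v, u) \<notin> D\<^sup>*"
        using acyclic_no_back_path[OF o(1) r_into_trancl[OF o(3)]] .
      then have "(v, u) \<notin> (D - {(u, v)})\<^sup>*"
        using rtrancl_mono[of "D - {(u, v)}" D] by blast
      moreover have "acyclic (D - {(u, v)})"
        by (rule acyclic_subset[OF o(1)]) auto
      moreover have "orientation (E - {{u, v}}) (D - {(u, v)})"
      proof (rule orientationI)
        fix x y assume xy: "(x, y) \<in> D - {(u, v)}"
        then have "(x, y) \<noteq> (v, u)" using o(4) by blast
        then show "{x, y} \<in> E - {{u, v}}"
          using xy orientationD(1)[OF o(2), of x y] by (auto simp: doubleton_eq_iff)
        show "(y, x) \<notin> D - {(u, v)}"
          using xy orientationD(2)[OF o(2), of x y] by simp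
      next
        fix x y assume "{x, y} \<in> E - {{u, v}}"
        then show "(x, y) \<in> D - {(u, v)} \<or> (y, x) \<in> D - {(u, v)}"
          using orientationD(3)[OF o(2), of x y] by (auto simp: doubleton_eq_iff)
      qed
      ultimately show "D - {(u, v)} \<in> ?B"
        by (simp add: acyclic_orientations_def)
    qed
    show "insert (u, v) \<in> ?B \<rightarrow> ?A"
    proof
      fix D assume D: "D \<in> ?B"
      then have o: "acyclic D" "orientation (E - {{u, v}}) D" "(v, u) \<notin> D\<^sup>*"
        by (auto simp: acyclic_orientations_def)
      have "(u, v) \<notin> D" "(v, u) \<notin> D"
        using orientationD(1)[OF o(2)] by (auto simp: insert_commute[of v u])
      have "orientation E (insert (u, v) D)"
      proof (rule orientationI)
        fix x y assume xy: "(x, y) \<in> insert (u, v) D"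
        then show "{x, y} \<in> E"
          using orientationD(1)[OF o(2), of x y] e by auto
        show "(y, x) \<notin> insert (u, v) D"
          using xy orientationD(2)[OF o(2), of x y] \<open>(v, u) \<notin> D\<close> e(2) by auto
      next
        fix x y assume "{x, y} \<in> E"
        then show "(x, y) \<in> insert (u, v) D \<or> (y, x) \<in> insert (u, v) D"
          using orientationD(3)[OF o(2), of x y] by (auto simp: doubleton_eq_iff)
      qed
      then show "insert (u, v) D \<in> ?A"
        using o by (simp add: acyclic_orientations_def acyclic_insert)
    qed
    show "insert (u, v) (D - {(u, v)}) = D" if "D \<in> ?A" for D
      using that by auto
    show "insert (u, v) D - {(u, v)} = D" if "D \<in> ?B" for D
      using that orientationD(1)[of "E - {{u, v}}" D u v] by (auto simp: acyclic_orientations_def)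
  qed
qed

lemma card_acyclic_orientations_delete:
  assumes G: "simple_graph V E" and e: "{u, v} \<in> E" "u \<noteq> v"
  shows "card (acyclic_orientations E) = card (acyclic_orientations (E - {{u, v}})) +
    card {D \<in> acyclic_orientations (E - {{u, v}}). (u, v) \<notin> D\<^sup>* \<and> (v, u) \<notin> D\<^sup>*}"
proof -
  let ?E' = "E - {{u, v}}"
  let ?A = "{D \<in> acyclic_orientations ?E'. (v, u) \<notin> D\<^sup>*}"
  let ?B = "{D \<in> acyclic_orientations ?E'. (u, v) \<notin> D\<^sup>*}"
  have fin: "finite (acyclic_orientations E)" "finite (acyclic_orientations ?E')"
    using G simple_graph_delete finite_acyclic_orientations by blast+
  have "card (acyclic_orientations E) =
      card ({D \<in> acyclic_orientations E. (u, v) \<in> D} \<union> {D \<in> acyclic_orientations E. (v, u) \<in> D})"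
    using orientationD(3)[OF _ e(1)]
    by (intro arg_cong[of _ _ card]) (auto simp: acyclic_orientations_def)
  also have "\<dots> = card {D \<in> acyclic_orientations E. (u, v) \<in> D} +
      card {D \<in> acyclic_orientations E. (v, u) \<in> D}"
  proof (rule card_Un_disjoint)
    show "{D \<in> acyclic_orientations E. (u, v) \<in> D} \<inter>
        {D \<in> acyclic_orientations E. (v, u) \<in> D} = {}"
      using orientationD(2)[of E _ u v] by (auto simp: acyclic_orientations_def)
  qed (use fin in auto)
  also have "\<dots> = card ?A + card ?B"
    using card_acyclic_orientations_arc[OF e]
      card_acyclic_orientations_arc[of v u E] e by (simp add: insert_commute[of v u])
  \<comment> \<open>No acyclic orientation of the smaller graph has paths in both directions between
    \<open>u\<close> and \<open>v\<close>, so \<open>?A\<close> and \<open>?B\<close> cover all of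
    them; those that admit either arc form the intersection.\<close>
  also have "\<dots> = card (?A \<union> ?B) + card (?A \<inter> ?B)"
    using fin by (intro card_Un_Int) auto
  also have "?A \<union> ?B = acyclic_orientations ?E'"
    using e acyclic_rtrancl_antisym by (fastforce simp: acyclic_orientations_def)
  also have "?A \<inter> ?B = {D \<in> acyclic_orientations ?E'. (u, v) \<notin> D\<^sup>* \<and> (v, u) \<notin> D\<^sup>*}"
    by auto
  finally show ?thesis .
qed

text \<open>Deletion minus contraction counts colourings, deletion plus contraction counts acyclic
  orientations. The contraction has one vertex fewer, so the sign \<open>(- 1) ^ card V\<close>
  turns the difference at -1 into the sum.\<close>

lemma ex_chromatic_poly:
  assumes "simple_graph V E"
  shows "\<exists>p :: int poly. (\<forall>k. poly p (int k) = int (card (proper_colourings V E k))) \<and>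
    poly p (- 1) = (- 1) ^ card V * int (card (acyclic_orientations E))"
  using assms
proof (induction "card E" arbitrary: V E rule: less_induct)
  case less
  show ?case
  proof (cases "E = {}")
    case True
    have "proper_colourings V E k = V \<rightarrow>\<^sub>E {..<k}" for k
      using True by (auto simp: proper_colourings_def)
    moreover have "acyclic_orientations E = {{}}"
      using True by (auto simp: acyclic_orientations_def orientation_def acyclic_def)
    moreover have "finite V"
      using less.prems by (simp add: simple_graph_def)
    ultimately show ?thesis
      by (intro exI[of _ "monom 1 (card V)"]) (simp add: poly_monom card_PiE)
  next
    case False
    then obtain e where "e \<in> E" by blast
    then obtain u v where e: "{u, v} \<in> E" and uv: "u \<noteq> v" "u \<in> V" "v \<in> V"
      using less.prems by (auto simp: simple_graph_def card_2_iff)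
    let ?E = "E - {{u, v}}"
    let ?C = "contract_edges ?E u v"
    have G: "simple_graph V ?E" and C: "simple_graph (V - {v}) ?C"
      using simple_graph_delete[OF less.prems, of "{u, v}"] simple_graph_contract[of V ?E u v] uv
      by simp_all
    \<comment> \<open>Only an inequality, since edges \<open>{u, w}\<close> and
      \<open>{v, w}\<close> become one.\<close>
    have "card ?C \<le> card ?E"
      unfolding contract_edges_def by (intro card_image_le finite_edges[OF G])
    moreover have lt: "card ?E < card E"
      using e finite_edges[OF less.prems] by (intro card_Diff1_less)
    ultimately have "card ?C < card E" by simp
    then obtain q where q: "\<And>k. poly q (int k) = int (card (proper_colourings (V - {v}) ?C k))"
      "poly q (- 1) = (- 1) ^ card (V - {v}) * int (card (acyclic_orientations ?C))"
      using less.hyps[OF _ C] by blast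
    obtain p where p: "\<And>k. poly p (int k) = int (card (proper_colourings V ?E k))"
      "poly p (- 1) = (- 1) ^ card V * int (card (acyclic_orientations ?E))"
      using less.hyps[OF lt G] by blast
    have V: "card V = Suc (card (V - {v}))"
      using card.remove[OF _ uv(3)] less.prems by (simp add: simple_graph_def)
    have "poly (p - q) (int k) = int (card (proper_colourings V E k))" for k
      using card_proper_colourings_delete[OF less.prems e, of k]
        card_proper_colourings_contract[OF G uv(2,3,1), of k] by (simp add: p q)
    moreover have "poly (p - q) (- 1) = (- 1) ^ card V * int (card (acyclic_orientations E))"
      using card_acyclic_orientations_delete[OF less.prems e uv(1)]
        card_acyclic_orientations_contract[OF G uv(2,1)]
      by (simp add: p q V algebra_simps)
    ultimately show ?thesis by blast
  qed
qed

text \<open>A nonzero polynomial has finitely many roots. This gives the uniqueness behind the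
  definite description in \<open>chromatic_poly\<close>.\<close>

lemma poly_eqI_nat:
  fixes p q :: "int poly"
  assumes "\<And>k::nat. poly p (int k) = poly q (int k)"
  shows "p = q"
proof (rule ccontr)
  assume "p \<noteq> q"
  then have "finite {x. poly (p - q) x = 0}"
    by (intro poly_roots_finite) simp
  moreover have "range int \<subseteq> {x. poly (p - q) x = 0}"
    using assms by auto
  ultimately have "finite (range int)"
    using finite_subset by blast
  then show False
    by (simp add: finite_image_iff)
qed

lemma abs_chromatic_poly_minus_one:
  assumes "simple_graph V E"
  shows "\<bar>poly (chromatic_poly V E) (- 1)\<bar> = int (card (acyclic_orientations E))"
proof -
  obtain p where p: "\<And>k. poly p (int k) = int (card (proper_colourings V E k))"
    "poly p (- 1) = (- 1) ^ card V * int (card (acyclic_orientations E))"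
    using ex_chromatic_poly[OF assms] by blast
  have "chromatic_poly V E = p"
    unfolding chromatic_poly_def
    by (rule the_equality) (use p(1) in \<open>auto intro: poly_eqI_nat\<close>)
  then show ?thesis
    using p(2) by (simp add: abs_mult power_abs)
qed

section \<open>Stationary distributions of the walk\<close>

lemma walk_law_cong:
  assumes "\<And>x. x \<in> S \<Longrightarrow> K x = K' x" "\<And>x. x \<in> S \<Longrightarrow> set_pmf (K x) \<subseteq> S" "x \<in> S"
  shows "walk_law K x t = walk_law K' x t"
proof -
  \<comment> \<open>The induction must also know that the last state stays in \<open>S\<close>,
    where the kernels agree.\<close>
  have "walk_law K x t = walk_law K' x t \<and> (\<forall>w\<in>set_pmf (walk_law K x t). last w \<in> S)"
  proof (induction t)
    case (Suc t)
    have "walk_law K x (Suc t) = walk_law K' x (Suc t)"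
      using Suc assms(1) by (auto intro!: bind_pmf_cong)
    moreover have "\<forall>w\<in>set_pmf (walk_law K x (Suc t)). last w \<in> S"
      using Suc assms(2) by fastforce
    ultimately show ?case by blast
  qed (use assms(3) in simp)
  then show ?thesis by blast
qed

text \<open>Distinct edges lead to distinct neighbours, so a uniform edge yields a uniform
  neighbour; without edges both kernels stay put.\<close>

lemma interval_reversal_step_eq:
  assumes "simple_graph V E" "D \<in> acyclic_orientations E"
  shows "interval_reversal_step E D = simple_walk_step (AO_inter_edges E) D"
  unfolding interval_reversal_step_def simple_walk_step_def neighbours_AO_inter[OF assms]
  using map_pmf_of_set_inj[OF inj_on_interval_reversal[OF assms]] finite_edges[OF assms(1)]
  by auto

lemma set_pmf_interval_reversal_step:
  assumes "simple_graph V E" "D \<in> acyclic_orientations E"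
  shows "set_pmf (interval_reversal_step E D) \<subseteq> acyclic_orientations E"
  using assms finite_edges[OF assms(1)] interval_reversal_in_acyclic_orientations[OF assms]
  by (auto simp: interval_reversal_step_def)

text \<open>Drawing the edge before the state turns the step into a mixture of the involutions
  \<open>\<lambda>D. interval_reversal D e\<close>.\<close>

lemma bind_interval_reversal_step:
  assumes "E \<noteq> {}"
  shows "bind_pmf \<pi> (interval_reversal_step E) =
    bind_pmf (pmf_of_set E) (\<lambda>e. map_pmf (\<lambda>D. interval_reversal D e) \<pi>)"
  using assms bind_commute_pmf[of \<pi> "pmf_of_set E" "\<lambda>D e. return_pmf (interval_reversal D e)"]
  by (simp add: interval_reversal_step_def[abs_def] map_pmf_def)

lemma pmf_map_interval_reversal:
  assumes "simple_graph V E" "e \<in> E" "set_pmf \<pi> \<subseteq> acyclic_orientations E"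
    "D \<in> acyclic_orientations E"
  shows "pmf (map_pmf (\<lambda>D. interval_reversal D e) \<pi>) D = pmf \<pi> (interval_reversal D e)"
proof -
  let ?r = "\<lambda>D. interval_reversal D e"
  have inv: "?r (?r D) = D" if "D \<in> acyclic_orientations E" for D
    using interval_reversal_involution[OF assms(1) that assms(2)] .
  have "pmf (map_pmf ?r \<pi>) D = measure (measure_pmf \<pi>) (?r -` {D})"
    by (simp add: pmf_map)
  \<comment> \<open>The two events are compared only almost surely, because \<open>?r\<close> is
    known to be an involution only on acyclic orientations, which carry all the mass of
    \<open>\<pi>\<close>.\<close>
  also have "\<dots> = measure (measure_pmf \<pi>) {?r D}"
    using assms(3) inv inv[OF assms(4)]
    by (intro measure_eq_AE AE_pmfI) auto
  finally show ?thesis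
    by (simp add: measure_pmf_single)
qed

text \<open>The mass that reaches \<open>D\<close> through the edge \<open>e\<close> comes from the
  single state \<open>interval_reversal D e\<close>, so a step averages the weights of the
  neighbours.\<close>

lemma pmf_bind_interval_reversal_step:
  assumes "simple_graph V E" "E \<noteq> {}" "set_pmf \<pi> \<subseteq> acyclic_orientations E"
    "D \<in> acyclic_orientations E"
  shows "pmf (bind_pmf \<pi> (interval_reversal_step E)) D =
    (\<Sum>e\<in>E. pmf \<pi> (interval_reversal D e)) / card E"
  unfolding bind_interval_reversal_step[OF assms(2)] pmf_bind
  using finite_edges[OF assms(1)] assms
  by (simp add: integral_pmf_of_set pmf_map_interval_reversal cong: sum.cong)

text \<open>Averaging equal weights returns the same weight, and no step leaves the state
  set.\<close>

lemma stationary_uniform: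
  assumes G: "simple_graph V E"
  shows "stationary_distribution (acyclic_orientations E) (interval_reversal_step E)
    (pmf_of_set (acyclic_orientations E))"
proof -
  let ?A = "acyclic_orientations E" and ?\<pi> = "pmf_of_set (acyclic_orientations E)"
  note fin = finite_acyclic_orientations[OF G] and ne = acyclic_orientations_nonempty[OF G]
  have set: "set_pmf ?\<pi> = ?A"
    using fin ne by simp
  have "bind_pmf ?\<pi> (interval_reversal_step E) = ?\<pi>"
  proof (cases "E = {}")
    case True
    then show ?thesis
      by (simp add: interval_reversal_step_def[abs_def] bind_return_pmf')
  next
    case False
    show ?thesis
    proof (rule pmf_eqI)
      fix D
      show "pmf (bind_pmf ?\<pi> (interval_reversal_step E)) D = pmf ?\<pi> D"
      proof (cases "D \<in> ?A")
        case True
        then have "pmf ?\<pi> (interval_reversal D e) = 1 / card ?A" if "e \<in> E" for e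
          using interval_reversal_in_acyclic_orientations[OF G _ that] fin ne by simp
        then show ?thesis
          using pmf_bind_interval_reversal_step[OF G False _ True, of ?\<pi>] set True fin ne
            False finite_edges[OF G] by simp
      next
        case F: False
        then have "D \<notin> set_pmf (bind_pmf ?\<pi> (interval_reversal_step E))"
          using set set_pmf_interval_reversal_step[OF G] by auto
        then show ?thesis
          using F set by (metis pmf_eq_0_set_pmf)
      qed
    qed
  qed
  then show ?thesis
    using set by (simp add: stationary_distribution_def)
qed

text \<open>Maximum principle: a stationary weight is the average of the weights at the neighbours,
  so the set where it is maximal is closed under taking neighbours.\<close>

lemma stationary_unique:
  assumes G: "simple_graph V E"
    and st: "stationary_distribution (acyclic_orientations E) (interval_reversal_step E) \<pi>"
  shows "\<pi> = pmf_of_set (acyclic_orientations E)"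
proof -
  let ?A = "acyclic_orientations E"
  note fin = finite_acyclic_orientations[OF G] and ne = acyclic_orientations_nonempty[OF G]
  have set: "set_pmf \<pi> \<subseteq> ?A" and fixed: "bind_pmf \<pi> (interval_reversal_step E) = \<pi>"
    using st by (auto simp: stationary_distribution_def)
  define M where "M = Max (pmf \<pi> ` ?A)"
  have le: "pmf \<pi> D \<le> M" if "D \<in> ?A" for D
    using that fin by (simp add: M_def)
  have "M \<in> pmf \<pi> ` ?A"
    unfolding M_def using fin ne by (intro Max_in) auto
  then obtain D0 where D0: "D0 \<in> ?A" "pmf \<pi> D0 = M"
    by auto
  have step: "pmf \<pi> (interval_reversal D e) = M" if D: "D \<in> ?A" "pmf \<pi> D = M" "e \<in> E" for D e
  proof -
    have E: "finite E" "E \<noteq> {}"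
      using finite_edges[OF G] that by auto
    have "(\<Sum>e\<in>E. pmf \<pi> (interval_reversal D e)) / card E = M"
      using pmf_bind_interval_reversal_step[OF G E(2) set D(1)] fixed D(2) by simp
    \<comment> \<open>The average equals the upper bound \<open>M\<close>, so the nonnegative
      deficits sum to zero and each of them vanishes.\<close>
    then have "(\<Sum>e\<in>E. M - pmf \<pi> (interval_reversal D e)) = 0"
      using E by (simp add: sum_subtractf field_simps)
    then show ?thesis
      using sum_nonneg_eq_0_iff[OF E(1), of "\<lambda>e. M - pmf \<pi> (interval_reversal D e)"]
        interval_reversal_in_acyclic_orientations[OF G D(1)] le D(3) by fastforce
  qed
  have const: "pmf \<pi> D = M" if "D \<in> ?A" for D
  proof -
    have "(D0, D) \<in> {(a, b). {a, b} \<in> AO_inter_edges E}\<^sup>*"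
      using connected_AO_inter[OF G] D0 that by (auto simp: connected_graph_def)
    then have "D \<in> ?A \<and> pmf \<pi> D = M"
    proof (induction rule: rtrancl_induct)
      case (step D D')
      then have "D' \<in> neighbours (AO_inter_edges E) D"
        by (simp add: neighbours_def)
      then obtain e where "e \<in> E" "D' = interval_reversal D e"
        using neighbours_AO_inter[OF G] step.IH by auto
      then show ?case
        using \<open>\<And>e D. \<lbrakk>D \<in> ?A; pmf \<pi> D = M; e \<in> E\<rbrakk> \<Longrightarrow> pmf \<pi> (interval_reversal D e) = M\<close>
          step.IH interval_reversal_in_acyclic_orientations[OF G] by auto
    qed (use D0 in simp)
    then show ?thesis by blast
  qed
  have "1 = (\<Sum>D\<in>?A. pmf \<pi> D)"
    using sum_pmf_eq_1[OF fin set] by simp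
  also have "\<dots> = card ?A * M"
    using const by simp
  finally have M: "M = 1 / card ?A"
    using fin ne by (simp add: field_simps)
  show ?thesis
  proof (rule pmf_eqI)
    fix D
    show "pmf \<pi> D = pmf (pmf_of_set ?A) D"
      using const[of D] M set fin ne by (cases "D \<in> ?A") (auto simp: set_pmf_iff)
  qed
qed

text \<open>The two walks are identified through the laws of all their finite trajectories;
  uniqueness of \<pi> is what permits speaking of the stationary distribution.\<close>

theorem theorem5p15:
  fixes V :: "'a set" and E :: "'a set set"
  assumes "simple_graph V E"
  shows "simple_graph (acyclic_orientations E) (AO_inter_edges E) \<and>
    connected_graph (acyclic_orientations E) (AO_inter_edges E) \<and>
    regular_graph (acyclic_orientations E) (AO_inter_edges E) (card E) \<and>
    (\<forall>D\<^sub>0 \<in> acyclic_orientations E. \<forall>t.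
       walk_law (interval_reversal_step E) D\<^sub>0 t =
       walk_law (simple_walk_step (AO_inter_edges E)) D\<^sub>0 t) \<and>
    (\<exists>\<pi>. stationary_distribution (acyclic_orientations E) (interval_reversal_step E) \<pi> \<and>
       (\<forall>\<pi>'. stationary_distribution (acyclic_orientations E) (interval_reversal_step E) \<pi>'
          \<longrightarrow> \<pi>' = \<pi>) \<and>
       (\<forall>D \<in> acyclic_orientations E.
          pmf \<pi> D = 1 / real_of_int \<bar>poly (chromatic_poly V E) (- 1)\<bar>))"
proof (intro conjI ballI allI exI[of _ "pmf_of_set (acyclic_orientations E)"] impI)
  show "walk_law (interval_reversal_step E) D t =
      walk_law (simple_walk_step (AO_inter_edges E)) D t"
    if "D \<in> acyclic_orientations E" for D t
    using interval_reversal_step_eq[OF assms] set_pmf_interval_reversal_step[OF assms] that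
    by (rule walk_law_cong)
  show "pmf (pmf_of_set (acyclic_orientations E)) D =
      1 / real_of_int \<bar>poly (chromatic_poly V E) (- 1)\<bar>"
    if "D \<in> acyclic_orientations E" for D
    unfolding abs_chromatic_poly_minus_one[OF assms]
    using that finite_acyclic_orientations[OF assms] acyclic_orientations_nonempty[OF assms] by simp
qed (fact simple_graph_AO_inter[OF assms] connected_AO_inter[OF assms] regular_AO_inter[OF assms]
    stationary_uniform[OF assms] | rule stationary_unique[OF assms], assumption)+

end
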